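(* Let $n\ge 1$ and let $\mathcal{U}_p\subseteq\mathbb{Z}_{2^n}$ be an incapable bit pattern (i.e. the index set of incapable bits resulting from some puncturing bit pattern of the polar code of length $2^n$). Let $\breve{\mathcal{U}}_p$ be the set of most dominant integers in $\mathcal{U}_p$. Then the family $\psi_{\mathcal{U}_p}$ of all puncturing bit patterns whose incapable bit pattern is $\mathcal{U}_p$ is $$\psi_{\mathcal{U}_p}=\Big\{\mathcal{A}\in\bigvee_{j\in\breve{\mathcal{U}}_p}\psi_j\ \Big|\ |\mathcal{A}|=|\mathcal{U}_p|\Big\}.$$
   Context: Let $\mathbb{Z}_{2^n}=\{0,1,\ldots,2^n-1\}$ and write $i=\sum_{t=0}^{n-1}i_t2^t$ with $i_t\in\{0,1\}$. Binary domination: $i\preceq j$ iff $i_t\le j_t$ for all $t$; $i\prec j$ iff $i\preceq j$ and $i\ne j$. An integer $j\in\mathcal{X}$ is most dominant in $\mathcal{X}$ if there is no $\ell\in\mathcal{X}$ with $j\prec\ell$. Puncturing model. The polar code of length $2^n$ encodes $\mathbf{u}\in\mathbb{F}_2^{2^n}$ to $\mathbf{x}=\mathbf{u}\left[\begin{smallmatrix}1&0\\1&1\end{smallmatrix}\right]^{\otimes n}$. A puncturing bit pattern is a set $\mathcal{X}_p\subseteq\mathbb{Z}_{2^n}$ of indices of encoder output bits that are not transmitted. Successive-cancellation (SC) decoding computes LLRs $\alpha_i^{(t)}$ for $i\in\mathbb{Z}_{2^n}$ and stages $t=n,n-1,\ldots,0$, whose zero pattern is governed by: $\alpha_i^{(n)}=0$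 iff $i\in\mathcal{X}_p$; for $t<n$ and $i_t=0$, $\alpha_i^{(t)}=0$ iff at least one of $\alpha_i^{(t+1)},\alpha_{i+2^t}^{(t+1)}$ is zero; for $t<n$ and $i_t=1$, $\alpha_i^{(t)}=0$ iff both $\alpha_{i-2^t}^{(t+1)}$ and $\alpha_i^{(t+1)}$ are zero. The bit $u_j$ is incapable if $\alpha_j^{(0)}=0$; the incapable bit pattern resulting from $\mathcal{X}_p$ is $\{j:\alpha_j^{(0)}=0\}$. $\psi_j$ denotes the family of minimal (with respect to inclusion) puncturing bit patterns required to make $u_j$ incapable, i.e. the inclusion-minimal sets $\mathcal{X}_p\subseteq\mathbb{Z}_{2^n}$ for which $u_j$ is incapable. Two puncturing bit patterns are widely equivalent if they give the same incapable bit pattern. For families of sets $\psi,\phi$, the cross-union is $\psi\vee\phi=\{\mathcal{A}\cup\mathcal{B}\mid\mathcal{A}\in\psi,\mathcal{B}\in\phi\}$, and $\bigvee$ denotes the iterated cross-union (the empty one being $\{\emptyset\}$). *)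

theory Defs
  imports Complex_Main
begin

(* Binary digits are given by the library: bit i t holds iff i_t = 1.  For
   numbers below 2 ^ n all digits from position n on vanish, so quantifying over
   all positions is the same as quantifying over t < n. *)

definition dominated :: "nat \<Rightarrow> nat \<Rightarrow> bool" where
  "dominated i j \<longleftrightarrow> (\<forall>t. bit i t \<longrightarrow> bit j t)"

definition strictly_dominated :: "nat \<Rightarrow> nat \<Rightarrow> bool" where
  "strictly_dominated i j \<longleftrightarrow> dominated i j \<and> i \<noteq> j"

definition most_dominant :: "nat set \<Rightarrow> nat set" where
  "most_dominant X = {j \<in> X. \<not> (\<exists>l \<in> X. strictly_dominated j l)}"

definition puncturing_patterns :: "nat \<Rightarrow> nat set set" where
  "puncturing_patterns n = Pow {0..<2 ^ n}"

(* llr_zero n X t i: the LLR alpha_i^(t) vanishes when the output bits indexed by X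
   are punctured.  Stages run downwards from t = n; values t > n play no role. *)

function llr_zero :: "nat \<Rightarrow> nat set \<Rightarrow> nat \<Rightarrow> nat \<Rightarrow> bool" where
  "llr_zero n X t i \<longleftrightarrow>
     (if n \<le> t then i \<in> X
      else if \<not> bit i t then llr_zero n X (t + 1) i \<or> llr_zero n X (t + 1) (i + 2 ^ t)
      else llr_zero n X (t + 1) (i - 2 ^ t) \<and> llr_zero n X (t + 1) i)"
  by pat_completeness auto
termination
  by (relation "measure (\<lambda>(n, X, t, i). n - t)") auto

declare llr_zero.simps [simp del]

definition incapable :: "nat \<Rightarrow> nat set \<Rightarrow> nat \<Rightarrow> bool" where
  "incapable n X j \<longleftrightarrow> llr_zero n X 0 j"

definition incapable_pattern :: "nat \<Rightarrow> nat set \<Rightarrow> nat set" where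
  "incapable_pattern n X = {j \<in> {0..<2 ^ n}. incapable n X j}"

definition patterns_resulting_in :: "nat \<Rightarrow> nat set \<Rightarrow> nat set set" where
  "patterns_resulting_in n U = {X \<in> puncturing_patterns n. incapable_pattern n X = U}"

definition minimal_patterns :: "nat \<Rightarrow> nat \<Rightarrow> nat set set" where
  "minimal_patterns n j =
     {X \<in> puncturing_patterns n. incapable n X j \<and>
        \<not> (\<exists>Y \<in> puncturing_patterns n. Y \<subset> X \<and> incapable n Y j)}"

definition cross_union :: "'a set set \<Rightarrow> 'a set set \<Rightarrow> 'a set set" where
  "cross_union F G = {A \<union> B | A B. A \<in> F \<and> B \<in> G}"

(* Cross-union is a commutative monoid with unit {{}}; cross_Union \<psi> J is the
   cross-union of the families \<psi> j for j in the finite set J. *)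

global_interpretation cross_Union: comm_monoid_set cross_union "{{}}"
  defines cross_Union = cross_Union.F
proof
  fix F G H :: "'a set set"
  show "cross_union (cross_union F G) H = cross_union F (cross_union G H)"
    unfolding cross_union_def by (auto, metis Un_assoc, metis Un_assoc)
  show "cross_union F G = cross_union G F"
    unfolding cross_union_def by blast
  show "cross_union F {{}} = F"
    unfolding cross_union_def by simp
qed

end

theory Submission
  imports Defs
begin

text \<open>
  Each decoding stage replaces the zero flags of a pair of positions by their disjunction and
  their conjunction, so the number of zeros is the same at all stages. The incapable pattern
  therefore has as many elements as the puncturing pattern; it is also monotone in it and closed
  under binary domination. If \<open>A\<close> is a union of patterns that make the most dominant elements of
  \<open>U\<close> incapable, then all of \<open>U\<close> is incapable under \<open>A\<close>, and counting forces equality as soon as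
  \<open>|A| = |U|\<close>. Conversely, a pattern resulting in \<open>U\<close> contains such a union of minimal patterns,
  and the same count shows that the inclusion is an equality.
\<close>

section \<open>Flipping a binary digit\<close>

lemma flip_bit_less_exp_nat:
  fixes i :: nat
  assumes "i < 2 ^ n" and "t < n"
  shows "flip_bit t i < 2 ^ n"
  using assms by (simp add: take_bit_flip_bit_eq flip: take_bit_nat_eq_self_iff)

lemma flip_bit_flip_bit_nat:
  fixes i :: nat
  shows "flip_bit t (flip_bit t i) = i"
  by (rule bit_eqI) (auto simp: bit_flip_bit_iff)

lemma flip_bit_nat_eq_add:
  fixes i :: nat
  shows "\<not> bit i t \<Longrightarrow> flip_bit t i = i + 2 ^ t"
  by (simp add: flip_bit_eq_if set_bit_eq)

lemma flip_bit_nat_eq_diff: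
  fixes i :: nat
  shows "bit i t \<Longrightarrow> flip_bit t i = i - 2 ^ t"
  \<comment> \<open>The flipped number has digit \<open>t\<close> clear, so the addition case
    applies to it, and flipping back gives \<open>i\<close>.\<close>
  using flip_bit_nat_eq_add[of "flip_bit t i" t]
  by (simp add: bit_flip_bit_iff flip_bit_flip_bit_nat)

lemma bit_nat_less_exp:
  fixes j :: nat
  assumes "j < 2 ^ n" and "bit j t"
  shows "t < n"
  using assms by (metis bit_take_bit_iff take_bit_nat_eq_self_iff)

lemma flip_bit_commute_nat:
  fixes i :: nat
  shows "flip_bit s (flip_bit t i) = flip_bit t (flip_bit s i)"
  by (rule bit_eqI) (auto simp: bit_flip_bit_iff)

section \<open>Monotonicity and domination in the decoding recursion\<close>

lemma llr_zero_final: "llr_zero n X n i \<longleftrightarrow> i \<in> X"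
  by (subst llr_zero.simps) simp

text \<open>In both cases the partner of \<open>i\<close> is \<open>flip_bit t i\<close>: a single
  involution replaces the addition and the truncated subtraction of the recursion.\<close>

lemma llr_zero_stage:
  assumes "t < n"
  shows "llr_zero n X t i \<longleftrightarrow>
    (if bit i t then llr_zero n X (Suc t) (flip_bit t i) \<and> llr_zero n X (Suc t) i
     else llr_zero n X (Suc t) i \<or> llr_zero n X (Suc t) (flip_bit t i))"
  using assms
  by (subst llr_zero.simps) (simp add: flip_bit_nat_eq_add flip_bit_nat_eq_diff)

lemma llr_zero_mono:
  assumes "X \<subseteq> Y" and "t \<le> n" and "llr_zero n X t i"
  shows "llr_zero n Y t i"
  using assms(2,3)
proof (induction t arbitrary: i rule: inc_induct)
  case base
  then show ?case
    using assms(1) by (auto simp: llr_zero_final)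
next
  case (step t)
  then show ?case
    by (auto simp: llr_zero_stage split: if_splits)
qed

text \<open>At stage \<open>s\<close> the conjunction of a pair implies its disjunction. Later
  stages combine along digits other than \<open>s\<close>; flips of different digits commute and the
  connectives are monotone, so the implication survives down to stage \<open>t\<close>.\<close>

lemma llr_zero_flip_bit:
  assumes "s < n" and "t \<le> s" and "bit i s" and "llr_zero n X t i"
  shows "llr_zero n X t (flip_bit s i)"
  using assms(2-4)
proof (induction t arbitrary: i rule: inc_induct)
  case base
  then show ?case
    using assms(1) by (simp add: llr_zero_stage bit_flip_bit_iff flip_bit_flip_bit_nat)
next
  case (step t)
  have "t < n" "t \<noteq> s"
    using step.hyps assms(1) by auto
  then show ?case
    using step.prems step.IH[of i] step.IH[of "flip_bit t i"]
    by (auto simp: llr_zero_stage bit_flip_bit_iff flip_bit_commute_nat[of t s] split: if_splits)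
qed

text \<open>Clear the digits of \<open>j\<close> that \<open>i\<close> lacks, one at a time: each
  result is smaller, still dominates \<open>i\<close> and stays incapable.\<close>

lemma incapable_dominated:
  assumes "dominated i j" and "j < 2 ^ n" and "incapable n X j"
  shows "incapable n X i"
  using assms
proof (induction j rule: less_induct)
  case (less j)
  show ?case
  proof (cases "i = j")
    case True
    then show ?thesis
      using less.prems by simp
  next
    case False
    then obtain t where t: "bit j t" "\<not> bit i t"
      using less.prems(1) unfolding dominated_def by (metis bit_eqI)
    have "t < n"
      using bit_nat_less_exp less.prems(2) t(1) by blast
    have "j > 0"
      using t(1) by (cases "j = 0") auto
    then have lt: "flip_bit t j < j"
      using t(1) by (simp add: flip_bit_nat_eq_diff)
    moreover have "dominated i (flip_bit t j)"
      using less.prems(1) t unfolding dominated_def by (auto simp: bit_flip_bit_iff)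
    moreover have "incapable n X (flip_bit t j)"
      using llr_zero_flip_bit[OF \<open>t < n\<close> _ t(1)] less.prems(3) by (simp add: incapable_def)
    ultimately show ?thesis
      using less.IH less.prems(2) by force
  qed
qed

section \<open>Conservation of the number of zeros\<close>

lemma sum_flip_bit:
  fixes f :: "nat \<Rightarrow> nat"
  assumes "t < n"
  shows "(\<Sum>i<2 ^ n. f (flip_bit t i)) = (\<Sum>i<2 ^ n. f i)"
  by (rule sum.reindex_bij_witness[where i = "flip_bit t" and j = "flip_bit t"])
    (use assms in \<open>auto simp: flip_bit_flip_bit_nat flip_bit_less_exp_nat\<close>)

lemma card_llr_zero_Suc:
  assumes "t < n"
  shows "card {i \<in> {..<2 ^ n}. llr_zero n X t i} = card {i \<in> {..<2 ^ n}. llr_zero n X (Suc t) i}"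
proof -
  define z where "z s i = (of_bool (llr_zero n X s i) :: nat)" for s i
  have card_eq: "card {i \<in> {..<2 ^ n}. llr_zero n X s i} = (\<Sum>i<2 ^ n. z s i)" for s
    by (simp add: z_def of_bool_def sum.If_cases Collect_conj_eq lessThan_def)
  \<comment> \<open>One member of the pair receives the disjunction and the other the conjunction,
    and together these count as much as the two flags.\<close>
  have pair: "z t i + z t (flip_bit t i) = z (Suc t) i + z (Suc t) (flip_bit t i)" for i
    using assms by (simp add: z_def llr_zero_stage bit_flip_bit_iff flip_bit_flip_bit_nat)
  \<comment> \<open>Summing over all \<open>i\<close> meets every pair twice, which avoids choosing
    representatives.\<close>
  have double: "2 * (\<Sum>i<2 ^ n. z s i) = (\<Sum>i<2 ^ n. z s i + z s (flip_bit t i))" for s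
    using assms by (simp add: sum.distrib sum_flip_bit)
  show ?thesis
    using double[of t] double[of "Suc t"] unfolding card_eq pair by linarith
qed

lemma card_incapable_pattern:
  assumes "X \<in> puncturing_patterns n"
  shows "card (incapable_pattern n X) = card X"
proof -
  have "card {i \<in> {..<2 ^ n}. llr_zero n X t i} = card X" if "t \<le> n" for t
    using that
  proof (induction t rule: inc_induct)
    case base
    have "{i \<in> {..<2 ^ n}. i \<in> X} = X"
      using assms by (auto simp: puncturing_patterns_def)
    then show ?case
      by (simp add: llr_zero_final)
  next
    case (step t)
    then show ?case
      by (metis card_llr_zero_Suc)
  qed
  from this[of 0] show ?thesis
    by (simp add: incapable_pattern_def incapable_def lessThan_atLeast0)
qed

section \<open>Most dominant elements, cross-unions and minimal patterns\<close>

lemma most_dominant_above: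
  assumes "finite U" and "i \<in> U"
  obtains j where "j \<in> most_dominant U" and "dominated i j"
proof -
  have trans: "dominated a c" if "dominated a b" "dominated b c" for a b c
    using that by (auto simp: dominated_def)
  have antisym: "a = b" if "dominated a b" "dominated b a" for a b
    using that by (auto simp: dominated_def intro: bit_eqI)
  \<comment> \<open>The dominating number comes first, so minimal elements for \<open>?D\<close> are
    maximal for domination.\<close>
  let ?D = "{(l, k). k \<in> U \<and> l \<in> U \<and> strictly_dominated k l}"
  have "finite ?D"
    by (rule finite_subset[of _ "U \<times> U"]) (use assms(1) in auto)
  moreover have "trans ?D"
    using trans antisym by (fastforce simp: strictly_dominated_def intro!: transI)
  \<comment> \<open>For a transitive relation, acyclicity is just irreflexivity.\<close>
  then have "acyclic ?D"
    by (auto simp: acyclic_def strictly_dominated_def)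
  ultimately have "wf ?D"
    by (rule finite_acyclic_wf)
  moreover have "i \<in> {k \<in> U. dominated i k}"
    using assms(2) by (simp add: dominated_def)
  ultimately obtain j where j: "j \<in> U" "dominated i j"
    "\<And>l. (l, j) \<in> ?D \<Longrightarrow> l \<notin> {k \<in> U. dominated i k}"
    by (rule wfE_min) blast
  have "j \<in> most_dominant U"
    using j trans by (fastforce simp: most_dominant_def strictly_dominated_def)
  with j(2) show thesis
    by (rule that[rotated])
qed

text \<open>Choice functions give direct access to the constituents of a member, so that the
  iterated operation itself can be left behind.\<close>

lemma mem_cross_Union_iff:
  assumes "finite J"
  shows "A \<in> cross_Union F J \<longleftrightarrow> (\<exists>a. (\<forall>j \<in> J. a j \<in> F j) \<and> A = (\<Union>j \<in> J. a j))"
  using assms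
proof (induction J arbitrary: A)
  case empty
  then show ?case
    by simp
next
  case (insert k J)
  have "A \<in> cross_Union F (insert k J) \<longleftrightarrow>
      (\<exists>B C. A = B \<union> C \<and> B \<in> F k \<and> C \<in> cross_Union F J)"
    using insert.hyps by (simp add: cross_union_def)
  also have "\<dots> \<longleftrightarrow> (\<exists>a. (\<forall>j \<in> insert k J. a j \<in> F j) \<and> A = (\<Union>j \<in> insert k J. a j))"
  proof
    assume "\<exists>B C. A = B \<union> C \<and> B \<in> F k \<and> C \<in> cross_Union F J"
    then obtain B a where a: "A = B \<union> (\<Union>j \<in> J. a j)" "B \<in> F k" "\<forall>j \<in> J. a j \<in> F j"
      using insert.IH by auto
    \<comment> \<open>Since \<open>k\<close> is not in \<open>J\<close>, the update at
      \<open>k\<close> does not disturb the union over \<open>J\<close>.\<close>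
    have "(\<Union>j \<in> J. (a(k := B)) j) = (\<Union>j \<in> J. a j)"
      using insert.hyps by (intro SUP_cong) auto
    with a insert.hyps show
      "\<exists>a. (\<forall>j \<in> insert k J. a j \<in> F j) \<and> A = (\<Union>j \<in> insert k J. a j)"
      by (intro exI[of _ "a(k := B)"]) auto
  next
    assume "\<exists>a. (\<forall>j \<in> insert k J. a j \<in> F j) \<and> A = (\<Union>j \<in> insert k J. a j)"
    then show "\<exists>B C. A = B \<union> C \<and> B \<in> F k \<and> C \<in> cross_Union F J"
      using insert.IH by auto
  qed
  finally show ?case .
qed

lemma minimal_pattern_below:
  assumes "X \<in> puncturing_patterns n" and "incapable n X j"
  obtains Y where "Y \<in> minimal_patterns n j" and "Y \<subseteq> X"
proof -
  let ?S = "{Y \<in> puncturing_patterns n. incapable n Y j}"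
  have "finite ?S"
    by (simp add: puncturing_patterns_def)
  then obtain Y where Y: "Y \<in> ?S" "Y \<subseteq> X" "\<forall>Z \<in> ?S. Z \<subseteq> Y \<longrightarrow> Y = Z"
    using finite_has_minimal2[of ?S X] assms by blast
  then have "Y \<in> minimal_patterns n j"
    by (auto simp: minimal_patterns_def)
  with Y(2) show thesis
    by (rule that[rotated])
qed

text \<open>This serves both inclusions of the theorem. Each element of \<open>U\<close> lies below
  some most dominant \<open>j\<close>; the pattern \<open>a j\<close> makes \<open>j\<close>
  incapable, enlarging it to the union preserves this, and domination passes it down.\<close>

lemma subset_incapable_pattern_UN:
  assumes "U \<subseteq> {0..<2 ^ n}" and "\<And>j. j \<in> most_dominant U \<Longrightarrow> a j \<in> minimal_patterns n j"
  shows "U \<subseteq> incapable_pattern n (\<Union>j \<in> most_dominant U. a j)"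
proof
  fix i assume "i \<in> U"
  moreover have "finite U"
    using assms(1) finite_subset by blast
  ultimately obtain j where j: "j \<in> most_dominant U" "dominated i j"
    using most_dominant_above by blast
  have "incapable n (a j) j"
    using assms(2)[OF j(1)] by (simp add: minimal_patterns_def)
  then have "incapable n (\<Union>j \<in> most_dominant U. a j) j"
    using j(1) llr_zero_mono[of "a j" _ 0] unfolding incapable_def by blast
  moreover have "j < 2 ^ n"
    using j(1) assms(1) by (auto simp: most_dominant_def)
  ultimately show "i \<in> incapable_pattern n (\<Union>j \<in> most_dominant U. a j)"
    using incapable_dominated[OF j(2)] \<open>i \<in> U\<close> assms(1) by (auto simp: incapable_pattern_def)
qed

theorem theorem14:
  fixes n :: nat and U :: "nat set"
  assumes "n \<ge> 1"
    and "\<exists>X \<in> puncturing_patterns n. incapable_pattern n X = U"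
  shows "patterns_resulting_in n U =
           {A \<in> cross_Union (minimal_patterns n) (most_dominant U). card A = card U}"
proof -
  have U: "U \<subseteq> {0..<2 ^ n}"
    using assms(2) by (auto simp: incapable_pattern_def)
  then have "finite (most_dominant U)"
    by (rule finite_subset[rotated, OF finite_subset]) (auto simp: most_dominant_def)
  note mem_iff = mem_cross_Union_iff[OF this]
  have UN: "(\<Union>j \<in> most_dominant U. a j) \<in> puncturing_patterns n"
    if "\<forall>j \<in> most_dominant U. a j \<in> minimal_patterns n j" for a
    using that by (force simp: minimal_patterns_def puncturing_patterns_def)
  show ?thesis
  proof (intro set_eqI iffI)
    fix X assume "X \<in> patterns_resulting_in n U"
    then have X: "X \<in> puncturing_patterns n" "incapable_pattern n X = U"
      by (auto simp: patterns_resulting_in_def)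
    then have card: "card X = card U"
      using card_incapable_pattern by metis
    have "\<exists>Y. Y \<in> minimal_patterns n j \<and> Y \<subseteq> X" if "j \<in> most_dominant U" for j
    proof -
      have "incapable n X j"
        using X(2) that by (auto simp: most_dominant_def incapable_pattern_def)
      then show ?thesis
        using minimal_pattern_below[OF X(1)] by blast
    qed
    then obtain a where a: "\<forall>j \<in> most_dominant U. a j \<in> minimal_patterns n j \<and> a j \<subseteq> X"
      by metis
    define A where "A = (\<Union>j \<in> most_dominant U. a j)"
    have "A \<subseteq> X"
      using a by (auto simp: A_def)
    have "card U \<le> card (incapable_pattern n A)"
      unfolding A_def using a U
      by (intro card_mono subset_incapable_pattern_UN) (auto simp: incapable_pattern_def)
    also have "\<dots> = card A"
      using a UN by (simp add: A_def card_incapable_pattern)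
    \<comment> \<open>A subset of the finite set \<open>X\<close> with at least
      \<open>card U = card X\<close> elements is all of \<open>X\<close>.\<close>
    finally have "A = X"
      using \<open>A \<subseteq> X\<close> card X(1)
      by (intro card_seteq) (auto simp: puncturing_patterns_def intro: finite_subset)
    then show "X \<in> {A \<in> cross_Union (minimal_patterns n) (most_dominant U). card A = card U}"
      using a card by (auto simp: mem_iff A_def)
  next
    fix A assume "A \<in> {A \<in> cross_Union (minimal_patterns n) (most_dominant U). card A = card U}"
    then obtain a where a: "\<forall>j \<in> most_dominant U. a j \<in> minimal_patterns n j"
      "A = (\<Union>j \<in> most_dominant U. a j)" and card: "card A = card U"
      by (auto simp: mem_iff)
    have A: "A \<in> puncturing_patterns n"
      using a UN by simp
    have "U = incapable_pattern n A"
    proof (rule card_seteq)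
      show "finite (incapable_pattern n A)"
        by (simp add: incapable_pattern_def)
      show "U \<subseteq> incapable_pattern n A"
        using subset_incapable_pattern_UN[OF U] a by simp
      show "card (incapable_pattern n A) \<le> card U"
        using card A by (simp add: card_incapable_pattern)
    qed
    with A show "A \<in> patterns_resulting_in n U"
      by (simp add: patterns_resulting_in_def)
  qed
qed

end
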